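(* Let $\mathcal{G}_{knet}$ be the kagome net framework in $\mathbb{R}^3$. (i) $\mathcal{G}_{knet}$ is square-summably isostatic and possesses no (nonzero) internal infinitesimal flexes. (ii) The mode multiplicity function $\mu:\mathbb{T}^3\to\mathbb{Z}_+$ of $\mathcal{G}_{knet}$ has support (the set of points where $\mu\neq0$) equal to the intersection of $\mathbb{T}^3=\{(z,w,u)\in\mathbb{C}^3:|z|=|w|=|u|=1\}$ with the six planes $$z=1,\quad w=1,\quad u=1,\quad z=w,\quad w=u,\quad u=z .$$
   Context: The kagome net $\mathcal{G}_{knet}=(F_v,F_e,\mathbb{Z}^3)$ is the crystal framework of vertex-joined regular tetrahedra given as follows. Let $q_0,q_1,q_2,q_3$ be the vertices of a regular tetrahedron, put $a_j=2(q_j-q_0)$ ($j=1,2,3$), $a_0=0$, and let $T_nx=x+n_1a_1+n_2a_2+n_3a_3$, $n\in\mathbb{Z}^3$. The motif has $F_v=\{q_0,\dots,q_3\}$ and $F_e$ consisting of the six tetrahedron edges $[q_i,q_j]$ together with six external edges, one for each pair $i<j$, extending the tetrahedron edge $[q_i,q_j]$ beyond $q_j$: $[q_j,\,q_i+(a_j-a_i)]$ where $q_i+(a_j-a_i)=2q_j-q_i$. The framework $(G,p)$, $G=(V,E)$, consists of all translates of $F_v$ and $F_e$. The rigidity matrix $R$ acts by $(Rf)_e=(p_v-p_w)\cdot(f_v-f_w)$ for an edge $e=vw$. An infinitesimal flex is a family $f=(f_v)_{v\in V}$ of vectors with $Rf=0$; it is internal if finitely supported. The framework is square-summably isostatic if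 there is no nonzero square-summable $f$ with $Rf=0$ and no nonzero square-summable $s=(s_e)_{e\in E}$ with $R^ts=0$ ($R^t$ the transpose). The matricial symbol function $\Phi$ of the motif is the $12\times12$ matrix function on $\mathbb{T}^3$ with rows indexed by $F_e$ and columns by pairs (motif vertex, coordinate direction): for a motif edge $e$ joining $T_m\kappa$ and $T_n\tau$ ($\kappa,\tau\in F_v$), with $v_e$ equal to the position of $T_m\kappa$ minus that of $T_n\tau$, row $e$ has entries $\bar z^{m_1}\bar w^{m_2}\bar u^{m_3}v_e$ in the columns of $\kappa$, $-\bar z^{n_1}\bar w^{n_2}\bar u^{n_3}v_e$ in the columns of $\tau$ and zero elsewhere. The mode multiplicity function is $\mu(z,w,u)=\dim\ker\Phi(z,w,u)$. *)

theory Defs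
  imports "HOL-Analysis.Analysis"
begin

section \<open>Bar-joint frameworks and the rigidity matrix\<close>

text \<open>Vertices are labels, placed in space by \<open>pos\<close>; an edge is a set of two vertices.\<close>

record ('v, 'p) framework =
  verts :: "'v set"
  edges :: "'v set set"
  pos :: "'v \<Rightarrow> 'p"

text \<open>
  Row \<open>e = {v, w}\<close> of the rigidity matrix has the vector \<open>p v - p w\<close> in the columns of \<open>v\<close>,
  \<open>p w - p v\<close> in those of \<open>w\<close>, and is zero elsewhere. Since \<open>p v - p v = 0\<close>, the sum over \<open>e\<close>
  picks out the difference with the other endpoint.
\<close>

definition rigidity_matrix :: "('v, 'p::real_inner) framework \<Rightarrow> 'v set \<Rightarrow> 'v \<Rightarrow> 'p" where
  "rigidity_matrix G e v = (if v \<in> e then \<Sum>w\<in>e. pos G v - pos G w else 0)"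

definition rigidity_map :: "('v, 'p::real_inner) framework \<Rightarrow> ('v \<Rightarrow> 'p) \<Rightarrow> 'v set \<Rightarrow> real" where
  "rigidity_map G f e = (\<Sum>v\<in>e. rigidity_matrix G e v \<bullet> f v)"

definition rigidity_transpose ::
    "('v, 'p::real_inner) framework \<Rightarrow> ('v set \<Rightarrow> real) \<Rightarrow> 'v \<Rightarrow> 'p" where
  "rigidity_transpose G s v = (\<Sum>e | e \<in> edges G \<and> v \<in> e. s e *\<^sub>R rigidity_matrix G e v)"

lemma rigidity_map_edge:
  assumes "v \<noteq> w"
  shows "rigidity_map G f {v, w} = (pos G v - pos G w) \<bullet> (f v - f w)"
  using assms
  by (simp add: rigidity_map_def rigidity_matrix_def inner_diff_left inner_diff_right)

text \<open>Vector families are total functions; only their values on \<open>verts G\<close> are meaningful.\<close>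

definition infinitesimal_flex :: "('v, 'p::real_inner) framework \<Rightarrow> ('v \<Rightarrow> 'p) \<Rightarrow> bool" where
  "infinitesimal_flex G f \<longleftrightarrow> (\<forall>e\<in>edges G. rigidity_map G f e = 0)"

definition internal_flex :: "('v, 'p::real_inner) framework \<Rightarrow> ('v \<Rightarrow> 'p) \<Rightarrow> bool" where
  "internal_flex G f \<longleftrightarrow> infinitesimal_flex G f \<and> finite {v \<in> verts G. f v \<noteq> 0}"

definition infinitesimal_stress :: "('v, 'p::real_inner) framework \<Rightarrow> ('v set \<Rightarrow> real) \<Rightarrow> bool" where
  "infinitesimal_stress G s \<longleftrightarrow> (\<forall>v\<in>verts G. rigidity_transpose G s v = 0)"

definition square_summable :: "'i set \<Rightarrow> ('i \<Rightarrow> 'b::real_normed_vector) \<Rightarrow> bool" where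
  "square_summable A f \<longleftrightarrow> (\<lambda>i. (norm (f i))\<^sup>2) summable_on A"

definition square_summably_isostatic :: "('v, 'p::real_inner) framework \<Rightarrow> bool" where
  "square_summably_isostatic G \<longleftrightarrow>
     \<not> (\<exists>f. square_summable (verts G) f \<and> infinitesimal_flex G f \<and> (\<exists>v\<in>verts G. f v \<noteq> 0)) \<and>
     \<not> (\<exists>s. square_summable (edges G) s \<and> infinitesimal_stress G s \<and> (\<exists>e\<in>edges G. s e \<noteq> 0))"

section \<open>Crystal frameworks in three dimensions\<close>

text \<open>
  The site \<open>(\<kappa>, n)\<close> stands for the vertex \<open>T\<^sub>n \<kappa>\<close>. A motif edge is recorded by its two end sites,
  in a chosen order; the order affects the symbol function only by the signs of its rows.
  The component \<open>periods $ j\<close> is the \<open>j\<close>-th period vector.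
\<close>

type_synonym 'k site = "'k \<times> (int^3)"

record 'k motif =
  motif_pos :: "'k \<Rightarrow> real^3"
  periods :: "(real^3)^3"
  motif_edges :: "('k site \<times> 'k site) set"

definition translation :: "'k motif \<Rightarrow> int^3 \<Rightarrow> real^3 \<Rightarrow> real^3" where
  "translation M n x = x + (\<Sum>j\<in>UNIV. of_int (n $ j) *\<^sub>R periods M $ j)"

definition site_pos :: "'k motif \<Rightarrow> 'k site \<Rightarrow> real^3" where
  "site_pos M = (\<lambda>(\<kappa>, n). translation M n (motif_pos M \<kappa>))"

definition crystal_framework :: "'k motif \<Rightarrow> ('k site, real^3) framework" where
  "crystal_framework M =
     \<lparr> verts = UNIV,
       edges = {{(\<kappa>, m + l), (\<tau>, n + l)} | \<kappa> m \<tau> n l. ((\<kappa>, m), (\<tau>, n)) \<in> motif_edges M},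
       pos = site_pos M \<rparr>"

text \<open>Hence the sum defining \<open>rigidity_transpose\<close> is finite for a finite motif.\<close>

lemma crystal_framework_locally_finite:
  assumes "finite (motif_edges M)"
  shows "finite {e \<in> edges (crystal_framework M). v \<in> e}"
proof -
  obtain \<rho> k where v: "v = (\<rho>, k)" by (cases v)
  let ?g = "\<lambda>((\<kappa>, m), (\<tau>, n)). {{(\<kappa>, m + (k - m)), (\<tau>, n + (k - m))}, {(\<kappa>, m + (k - n)), (\<tau>, n + (k - n))}}"
  have "{e \<in> edges (crystal_framework M). v \<in> e} \<subseteq> (\<Union>x\<in>motif_edges M. ?g x)"
  proof
    fix e assume "e \<in> {e \<in> edges (crystal_framework M). v \<in> e}"
    then obtain \<kappa> m \<tau> n l where e: "e = {(\<kappa>, m + l), (\<tau>, n + l)}"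
      and me: "((\<kappa>, m), (\<tau>, n)) \<in> motif_edges M" and "v \<in> e"
      by (auto simp: crystal_framework_def)
    then have "l = k - m \<or> l = k - n" using v by auto
    then have "e \<in> ?g ((\<kappa>, m), (\<tau>, n))" using e by auto
    then show "e \<in> (\<Union>x\<in>motif_edges M. ?g x)" using me by blast
  qed
  moreover have "finite (\<Union>x\<in>motif_edges M. ?g x)" using assms by auto
  ultimately show ?thesis by (rule finite_subset)
qed

definition torus3 :: "(complex \<times> complex \<times> complex) set" where
  "torus3 = {(z, w, u). cmod z = 1 \<and> cmod w = 1 \<and> cmod u = 1}"

definition conj_monomial :: "complex \<times> complex \<times> complex \<Rightarrow> int^3 \<Rightarrow> complex" where
  "conj_monomial = (\<lambda>(z, w, u) n. cnj z powi (n $ 1) * cnj w powi (n $ 2) * cnj u powi (n $ 3))"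

text \<open>Entry of \<open>\<Phi>(z, w, u)\<close> in the row of a motif edge and the column of a (motif vertex, coordinate).\<close>

fun matricial_symbol ::
    "'k motif \<Rightarrow> complex \<times> complex \<times> complex \<Rightarrow> 'k site \<times> 'k site \<Rightarrow> 'k \<times> 3 \<Rightarrow> complex" where
  "matricial_symbol M \<zeta> ((\<kappa>, m), (\<tau>, n)) (\<rho>, i) =
     (let v = site_pos M (\<kappa>, m) - site_pos M (\<tau>, n)
      in (if \<rho> = \<kappa> then conj_monomial \<zeta> m * of_real (v $ i) else 0)
       - (if \<rho> = \<tau> then conj_monomial \<zeta> n * of_real (v $ i) else 0))"

definition symbol_kernel ::
    "'k::finite motif \<Rightarrow> complex \<times> complex \<times> complex \<Rightarrow> (complex^('k \<times> 3)) set" where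
  "symbol_kernel M \<zeta> =
     {x. \<forall>e\<in>motif_edges M. (\<Sum>c\<in>UNIV. matricial_symbol M \<zeta> e c * x $ c) = 0}"

text \<open>The plain constant \<open>dim\<close> would be the real dimension; \<open>vec.dim\<close> is the complex one here.\<close>

definition mode_multiplicity :: "'k::finite motif \<Rightarrow> complex \<times> complex \<times> complex \<Rightarrow> nat" where
  "mode_multiplicity M \<zeta> = vec.dim (symbol_kernel M \<zeta>)"

section \<open>The kagome net\<close>

definition regular_tetrahedron :: "(4 \<Rightarrow> real^3) \<Rightarrow> bool" where
  "regular_tetrahedron q \<longleftrightarrow> (\<exists>d>0. \<forall>i j. i \<noteq> j \<longrightarrow> dist (q i) (q j) = d)"

text \<open>
  The index type \<open>4\<close> is the integers modulo 4, with elements ordered as \<open>0 < 1 < 2 < 3\<close>.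
  \<open>unit_shift j\<close> is the exponent \<open>n\<close> with \<open>T\<^sub>n x = x + a\<^sub>j\<close>, where \<open>a\<^sub>0 = 0\<close>.
\<close>

definition unit_shift :: "4 \<Rightarrow> int^3" where
  "unit_shift j =
     (if j = 1 then axis 1 1 else if j = 2 then axis 2 1 else if j = 3 then axis 3 1 else 0)"

definition kagome_net :: "(4 \<Rightarrow> real^3) \<Rightarrow> 4 motif" where
  "kagome_net q =
     \<lparr> motif_pos = q,
       periods = vector [2 *\<^sub>R (q 1 - q 0), 2 *\<^sub>R (q 2 - q 0), 2 *\<^sub>R (q 3 - q 0)],
       motif_edges = {((i, 0), (j, 0)) | i j. i < j}
                   \<union> {((j, 0), (i, unit_shift j - unit_shift i)) | i j. i < j} \<rparr>"

lemma index_pairs: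
  "{(i, j). i < (j::4)} = {(0, 1), (0, 2), (0, 3), (1, 2), (1, 3), (2, 3)}"
proof -
  have a: "Rep_bit0 (0::4) = 0" "Rep_bit0 (1::4) = 1" "Rep_bit0 (2::4) = 2" "Rep_bit0 (3::4) = 3"
    using bit0.Rep_0[where 'a=2] bit0.Rep_1[where 'a=2] bit0.Rep_numeral[where 'a=2] by simp_all
  have e: "i = 0 \<or> i = 1 \<or> i = 2 \<or> i = 3" for i :: 4
    using exhaust_4[of i] by auto
  have "i < j \<longleftrightarrow> (i, j) \<in> {(0, 1), (0, 2), (0, 3), (1, 2), (1, 3), (2, 3)}" for i j :: 4
    using e[of i] e[of j] by (elim disjE) (simp_all add: less_bit0_def a)
  then show ?thesis by blast
qed

text \<open>The external edges end at \<open>q i + (a\<^sub>j - a\<^sub>i) = 2 q j - q i\<close>.\<close>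

lemma kagome_net_external_end:
  "site_pos (kagome_net q) (i, unit_shift j - unit_shift i) = 2 *\<^sub>R q j - q i"
proof -
  have four: "(4::4) = 0" by simp
  have "site_pos (kagome_net q) (i, unit_shift j - unit_shift i)
      = q i + (2 *\<^sub>R (q j - q 0) - 2 *\<^sub>R (q i - q 0))"
    using exhaust_4[of i] exhaust_4[of j] unfolding four
    by (auto simp: site_pos_def translation_def kagome_net_def sum_3 unit_shift_def axis_def
        algebra_simps)
  also have "\<dots> = 2 *\<^sub>R q j - q i"
    by (simp add: vec_eq_iff)
  finally show ?thesis .
qed

end

theory Submission
  imports Defs
begin

text \<open>
The bars of the kagome net lie on straight lines: the two bars at a vertex \<open>(i, n)\<close> in the
direction \<open>q i - q j\<close> are opposite, one inside the tetrahedron of that vertex and one leading to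
the neighbouring tetrahedron. So the line through \<open>(i, n)\<close> in this direction visits vertices of the
two kinds \<open>i\<close> and \<open>j\<close> alternately, and every two bars along it advance the cell by the same nonzero
lattice vector (lemma \<open>kagome_edges\<close> describes the bars in this symmetric form).

A flex condition at a bar says that the components of the two end velocities along the bar
agree. Along a line, all bars have the same direction, so this component is constant on the
whole line. Dually, equilibrium at a vertex is a linear relation between the three pairs of opposite
bars; since the three edge directions at a vertex of a tetrahedron are linearly independent, the
stresses of opposite bars agree, and a stress is constant on every line. A line is infinite and
a square-summable family tends to zero along it, so the constants vanish. For a stress this is the
claim, and for a flex it says that each velocity is orthogonal to three independent directions.
Internal flexes are square-summable, being finitely supported.

For the symbol function, the two rows belonging to \<open>i < j\<close> say that the component \<open>c\<close> along \<open>q i - q j\<close>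
is the same at the motif vertices \<open>i\<close> and \<open>j\<close>, and that \<open>c\<close> equals itself times a quotient of two of
the phases \<open>1, z, w, u\<close> (conjugated). If the four phases are distinct then all components vanish, and so
does the vector, again by independence. If two phases coincide then a nonzero vector, supported
on the two vertices concerned, is in the kernel: each of the two is given a velocity orthogonal to
its other two edges. The six planes are the six ways in which two of \<open>1, z, w, u\<close> can coincide.
\<close>

section \<open>Regular tetrahedra\<close>

lemma other_vertices_card: "card {j::4. j \<noteq> i} = 3"
proof -
  have "{j::4. j \<noteq> i} = UNIV - {i}" by auto
  then show ?thesis by (simp add: card_Diff_singleton)
qed

text \<open>
The vector \<open>h j\<close> is a multiple of the altitude from vertex \<open>j\<close>: the other three vertices all have
the same distance to \<open>q j\<close> and the same distance to the centroid, so the edges between them are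
orthogonal to the direction from \<open>q j\<close> to the centroid. For every \<open>i\<close>, the \<open>h j\<close> with \<open>j \<noteq> i\<close> thus form the basis
dual to the three edges at \<open>i\<close>.
\<close>

lemma regular_tetrahedron_dual_vectors:
  fixes q :: "4 \<Rightarrow> real^3"
  assumes "regular_tetrahedron q"
  obtains h where "\<And>i j. i \<noteq> j \<Longrightarrow> (q i - q j) \<bullet> h j = 1"
    and "\<And>i j k. i \<noteq> j \<Longrightarrow> k \<noteq> j \<Longrightarrow> (q i - q k) \<bullet> h j = 0"
proof -
  obtain d where d: "d > 0" and D: "\<And>i j. i \<noteq> j \<Longrightarrow> dist (q i) (q j) = d"
    using assms unfolding regular_tetrahedron_def by blast
  have gram: "(q i - q j) \<bullet> (q k - q j) = (if k = j then 0 else if k = i then d\<^sup>2 else d\<^sup>2 / 2)"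
    if "i \<noteq> j" for i j k
  proof -
    have "(q i - q j) \<bullet> (q k - q j)
        = ((dist (q i) (q j))\<^sup>2 + (dist (q k) (q j))\<^sup>2 - (dist (q i) (q k))\<^sup>2) / 2"
      by (simp add: dist_norm power2_norm_eq_inner inner_diff inner_commute algebra_simps)
    then show ?thesis using that by (auto simp: D)
  qed
  have total: "(q i - q j) \<bullet> (\<Sum>k\<in>UNIV. q k - q j) = 2 * d\<^sup>2" if "i \<noteq> j" for i j
  proof -
    have "(q i - q j) \<bullet> (\<Sum>k\<in>UNIV. q k - q j)
        = (\<Sum>k\<in>UNIV. d\<^sup>2 / 2 - (if k = j then d\<^sup>2 / 2 else 0) + (if k = i then d\<^sup>2 / 2 else 0))"
      unfolding inner_sum_right using that by (intro sum.cong refl) (auto simp: gram)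
    also have "\<dots> = 2 * d\<^sup>2"
      by (simp add: sum.distrib sum_subtractf)
    finally show ?thesis .
  qed
  \<comment> \<open>The sum is four times the vector from \<open>q j\<close> to the centroid.\<close>
  define h where "h j = (1 / (2 * d\<^sup>2)) *\<^sub>R (\<Sum>k\<in>UNIV. q k - q j)" for j
  have one: "(q i - q j) \<bullet> h j = 1" if "i \<noteq> j" for i j
    using d total[OF that] by (simp add: h_def)
  show ?thesis
  proof (rule that[OF one])
    fix i j k :: 4 assume "i \<noteq> j" "k \<noteq> j"
    have "(q i - q k) \<bullet> h j = (q i - q j) \<bullet> h j - (q k - q j) \<bullet> h j"
      by (simp add: inner_diff_left)
    then show "(q i - q k) \<bullet> h j = 0"
      using one[OF \<open>i \<noteq> j\<close>] one[OF \<open>k \<noteq> j\<close>] by simp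
  qed assumption
qed

text \<open>
The dual vectors read off the coefficients of a linear combination.
\<close>

lemma tetrahedron_edges_independent:
  fixes q :: "4 \<Rightarrow> real^3"
  assumes "regular_tetrahedron q"
    and "(\<Sum>j | j \<noteq> i. c j *\<^sub>R (q i - q j)) = 0" and "k \<noteq> i"
  shows "c k = 0"
proof -
  obtain h where one: "\<And>i j. i \<noteq> j \<Longrightarrow> (q i - q j) \<bullet> h j = 1"
    and zero: "\<And>i j k. i \<noteq> j \<Longrightarrow> k \<noteq> j \<Longrightarrow> (q i - q k) \<bullet> h j = 0"
    using regular_tetrahedron_dual_vectors[OF assms(1)] by blast
  have "0 = (\<Sum>j | j \<noteq> i. c j *\<^sub>R (q i - q j)) \<bullet> h k"
    using assms(2) by simp
  also have "\<dots> = (\<Sum>j | j \<noteq> i. if j = k then c k else 0)"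
    unfolding inner_sum_left using assms(3) by (intro sum.cong refl) (auto simp: one zero)
  also have "\<dots> = c k" using assms(3) by simp
  finally show ?thesis by simp
qed

text \<open>
Three independent vectors span the space, so only zero is orthogonal to all of them.
\<close>

lemma tetrahedron_edges_separate:
  fixes q :: "4 \<Rightarrow> real^3"
  assumes tet: "regular_tetrahedron q"
    and orth: "\<And>j. j \<noteq> i \<Longrightarrow> (q i - q j) \<bullet> f = 0"
  shows "f = 0"
proof -
  let ?B = "(\<lambda>j. q i - q j) ` {j. j \<noteq> i}"
  have "inj q"
    using tet unfolding regular_tetrahedron_def inj_def by (metis dist_self less_irrefl)
  then have inj: "inj_on (\<lambda>j. q i - q j) {j. j \<noteq> i}"
    by (auto intro!: inj_onI dest: injD)
  have "independent ?B"
  proof (rule real_vector.independent_if_scalars_zero)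
    fix c x assume "(\<Sum>x\<in>?B. c x *\<^sub>R x) = 0" "x \<in> ?B"
    then show "c x = 0"
      using tetrahedron_edges_independent[OF tet, where i = i and c = "\<lambda>j. c (q i - q j)"]
      by (auto simp: sum.reindex[OF inj])
  qed simp
  moreover have "card ?B = dim (UNIV :: (real^3) set)"
    using inj by (simp add: card_image other_vertices_card)
  ultimately have "UNIV \<subseteq> span ?B"
    using card_eq_dim[of ?B UNIV] by simp
  then have "orthogonal f f"
    by (intro orthogonal_to_span[of f ?B]) (auto simp: orthogonal_def inner_commute[of f] orth)
  then show ?thesis by (simp add: orthogonal_def)
qed

section \<open>Square-summable families\<close>

lemma square_summable_tendsto_0:
  fixes g :: "nat \<Rightarrow> 'i"
  assumes "square_summable A f" and "inj g" and "range g \<subseteq> A"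
  shows "(\<lambda>k. f (g k)) \<longlonglongrightarrow> 0"
proof -
  have "(\<lambda>i. (norm (f i))\<^sup>2) summable_on range g"
    using assms(1,3) unfolding square_summable_def by (rule summable_on_subset_banach)
  then have "(\<lambda>k. (norm (f (g k)))\<^sup>2) summable_on UNIV"
    by (simp add: summable_on_reindex[OF assms(2)] o_def)
  then have "summable (\<lambda>k. (norm (f (g k)))\<^sup>2)"
    by (rule summable_on_imp_summable)
  then have "(\<lambda>k. (norm (f (g k)))\<^sup>2) \<longlonglongrightarrow> 0"
    by (rule summable_LIMSEQ_zero)
  then have "(\<lambda>k. norm (f (g k))) \<longlonglongrightarrow> 0"
    by simp
  then show ?thesis by (rule tendsto_norm_zero_cancel)
qed

lemma finite_support_square_summable:
  assumes "finite {i \<in> A. f i \<noteq> 0}"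
  shows "square_summable A f"
proof -
  have "(\<lambda>i. (norm (f i))\<^sup>2) summable_on {i \<in> A. f i \<noteq> 0}"
    using assms by (rule summable_on_finite)
  then show ?thesis unfolding square_summable_def
    by (rule summable_on_cong_neutral[THEN iffD1, rotated -1]) auto
qed

section \<open>Bars of the kagome net\<close>

text \<open>
Equilibrium is easier to handle as a sum over neighbouring vertices than over sets of two
vertices; without loops the two index sets correspond.
\<close>

lemma rigidity_transpose_neighbours:
  assumes "\<And>e. e \<in> edges G \<Longrightarrow> \<exists>v w. v \<noteq> w \<and> e = {v, w}"
  shows "rigidity_transpose G s v
       = (\<Sum>w | {v, w} \<in> edges G. s {v, w} *\<^sub>R (pos G v - pos G w))"
proof -
  have loop: "w \<noteq> v" if "{v, w} \<in> edges G" for w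
    using assms[OF that] by (auto simp: doubleton_eq_iff)
  have inj: "inj_on (\<lambda>w. {v, w}) {w. {v, w} \<in> edges G}"
    by (auto simp: inj_on_def doubleton_eq_iff)
  have "{e. e \<in> edges G \<and> v \<in> e} = (\<lambda>w. {v, w}) ` {w. {v, w} \<in> edges G}"
  proof (intro set_eqI iffI)
    fix e assume e: "e \<in> {e. e \<in> edges G \<and> v \<in> e}"
    then obtain a b where "e = {a, b}" using assms[of e] by blast
    then have "\<exists>w. e = {v, w}" using e by auto
    then show "e \<in> (\<lambda>w. {v, w}) ` {w. {v, w} \<in> edges G}" using e by auto
  qed auto
  then have "rigidity_transpose G s v
      = (\<Sum>w | {v, w} \<in> edges G. s {v, w} *\<^sub>R rigidity_matrix G {v, w} v)"
    unfolding rigidity_transpose_def by (simp add: sum.reindex[OF inj])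
  also have "\<dots> = (\<Sum>w | {v, w} \<in> edges G. s {v, w} *\<^sub>R (pos G v - pos G w))"
    by (intro sum.cong refl) (auto simp: rigidity_matrix_def loop[symmetric])
  finally show ?thesis .
qed

lemma unit_shift_inj: "inj unit_shift"
proof -
  have four: "(4::4) = 0" by simp
  have "unit_shift i = unit_shift j \<Longrightarrow> i = j" for i j
    using exhaust_4[of i] exhaust_4[of j] unfolding four
    by (auto simp: unit_shift_def axis_eq_axis axis_eq_0_iff)
  then show ?thesis by (rule injI)
qed

lemma site_pos_add: "site_pos M (\<kappa>, n + m) = translation M n (site_pos M (\<kappa>, m))"
  by (simp add: site_pos_def translation_def scaleR_add_left sum.distrib)

lemma internal_bar: "site_pos (kagome_net q) (i, n) - site_pos (kagome_net q) (j, n) = q i - q j"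
  by (simp add: site_pos_def translation_def kagome_net_def)

lemma external_bar:
  "site_pos (kagome_net q) (i, n)
     - site_pos (kagome_net q) (j, n + (unit_shift i - unit_shift j)) = q j - q i"
proof -
  have "site_pos (kagome_net q) (i, n) - translation (kagome_net q) n (2 *\<^sub>R q i - q j) = q j - q i"
    by (simp add: site_pos_def translation_def kagome_net_def scaleR_2)
  then show ?thesis by (simp only: site_pos_add kagome_net_external_end)
qed

lemma crystal_framework_edgeI:
  assumes "((\<kappa>, m), (\<tau>, n)) \<in> motif_edges M"
  shows "{(\<kappa>, m + l), (\<tau>, n + l)} \<in> edges (crystal_framework M)"
proof -
  have "edges (crystal_framework M)
      = {{(\<kappa>, m + l), (\<tau>, n + l)} | \<kappa> m \<tau> n l. ((\<kappa>, m), (\<tau>, n)) \<in> motif_edges M}"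
    by (simp add: crystal_framework_def)
  then show ?thesis using assms by blast
qed

text \<open>
The motif distinguishes \<open>i < j\<close> only in order to list each bar once. As unordered pairs, the
internal bars are symmetric in \<open>i\<close> and \<open>j\<close>, and an external bar seen from its other end has the same
form with \<open>i\<close> and \<open>j\<close> exchanged.
\<close>

lemma kagome_edges:
  "edges (crystal_framework (kagome_net q))
     = {{(i, n), (j, n)} | i j n. i \<noteq> j}
     \<union> {{(i, n), (j, n + (unit_shift i - unit_shift j))} | i j n. i \<noteq> j}" (is "?E = ?I \<union> ?X")
proof
  show "?E \<subseteq> ?I \<union> ?X"
  proof
    fix e assume "e \<in> ?E"
    then obtain \<kappa> m \<tau> n l where e: "e = {(\<kappa>, m + l), (\<tau>, n + l)}"
      and "((\<kappa>, m), (\<tau>, n)) \<in> motif_edges (kagome_net q)"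
      by (auto simp: crystal_framework_def)
    then consider "m = 0" "n = 0" "\<kappa> < \<tau>" | "m = 0" "n = unit_shift \<kappa> - unit_shift \<tau>" "\<tau> < \<kappa>"
      by (auto simp: kagome_net_def)
    then show "e \<in> ?I \<union> ?X"
    proof cases
      case 1
      then have "e = {(\<kappa>, l), (\<tau>, l)}" "\<kappa> \<noteq> \<tau>" using e by auto
      then show ?thesis by blast
    next
      case 2
      then have "e = {(\<kappa>, l), (\<tau>, l + (unit_shift \<kappa> - unit_shift \<tau>))}" "\<kappa> \<noteq> \<tau>"
        using e by (auto simp: add.commute)
      then show ?thesis by blast
    qed
  qed
  have I: "{(i, n), (j, n)} \<in> ?E" if "i < j" for i j n
  proof -
    have "((i, 0), (j, 0)) \<in> motif_edges (kagome_net q)"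
      using that by (simp add: kagome_net_def)
    then have "{(i, 0 + n), (j, 0 + n)} \<in> ?E"
      by (rule crystal_framework_edgeI)
    then show ?thesis by simp
  qed
  have X: "{(i, n), (j, n + (unit_shift i - unit_shift j))} \<in> ?E" if "j < i" for i j n
  proof -
    have "((i, 0), (j, unit_shift i - unit_shift j)) \<in> motif_edges (kagome_net q)"
      using that by (simp add: kagome_net_def)
    then have "{(i, 0 + n), (j, (unit_shift i - unit_shift j) + n)} \<in> ?E"
      by (rule crystal_framework_edgeI)
    then show ?thesis by (simp add: add.commute)
  qed
  show "?I \<union> ?X \<subseteq> ?E"
  proof
    fix e assume "e \<in> ?I \<union> ?X"
    then consider i j n where "i \<noteq> j" "e = {(i, n), (j, n)}"
      | i j n where "i \<noteq> j" "e = {(i, n), (j, n + (unit_shift i - unit_shift j))}" by blast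
    then show "e \<in> ?E"
    proof cases
      case 1
      then show ?thesis using I[of i j n] I[of j i n] by (metis insert_commute neq_iff)
    next
      case 2
      let ?m = "n + (unit_shift i - unit_shift j)"
      have "e = {(j, ?m), (i, ?m + (unit_shift j - unit_shift i))}"
        using 2 by (simp add: insert_commute)
      then show ?thesis using 2 X[of j i n] X[of i j ?m] by (metis neq_iff)
    qed
  qed
qed

lemma kagome_neighbours:
  "{w. {(i, n), w} \<in> edges (crystal_framework (kagome_net q))}
     = (\<lambda>j. (j, n)) ` {j. j \<noteq> i} \<union> (\<lambda>j. (j, n + (unit_shift i - unit_shift j))) ` {j. j \<noteq> i}"
proof -
  have "{(i, n), (k, m)} \<in> edges (crystal_framework (kagome_net q)) \<longleftrightarrow>
      k \<noteq> i \<and> (m = n \<or> m = n + (unit_shift i - unit_shift k))"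
    (is "?e \<in> _ \<longleftrightarrow> ?R") for k m
  proof
    show "?e \<in> edges (crystal_framework (kagome_net q)) \<Longrightarrow> ?R"
      unfolding kagome_edges by (auto simp: doubleton_eq_iff)
    show "?R \<Longrightarrow> ?e \<in> edges (crystal_framework (kagome_net q))"
      unfolding kagome_edges by blast
  qed
  then show ?thesis by auto
qed

text \<open>
The internal and the external bar from \<open>(i, n)\<close> to vertices of kind \<open>j\<close> have opposite directions, so
only the difference of their stresses enters the resultant force at the vertex.
\<close>

lemma kagome_stress_balance:
  "rigidity_transpose (crystal_framework (kagome_net q)) s (i, n)
     = (\<Sum>j | j \<noteq> i. (s {(i, n), (j, n)} - s {(i, n), (j, n + (unit_shift i - unit_shift j))})
          *\<^sub>R (q i - q j))"
proof -
  let ?G = "crystal_framework (kagome_net q)"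
  let ?O = "{j. j \<noteq> i}" and ?x = "\<lambda>j. (j, n + (unit_shift i - unit_shift j))"
  have bar: "\<exists>v w. v \<noteq> w \<and> e = {v, w}" if "e \<in> edges ?G" for e
    using that unfolding kagome_edges by fastforce
  \<comment> \<open>The two bars of a pair end at different vertices, since the period vectors are distinct.\<close>
  have disj: "(\<lambda>j. (j, n)) ` ?O \<inter> ?x ` ?O = {}"
    using unit_shift_inj by (auto simp: inj_def)
  have "rigidity_transpose ?G s (i, n)
      = (\<Sum>w | {(i, n), w} \<in> edges ?G. s {(i, n), w} *\<^sub>R (pos ?G (i, n) - pos ?G w))"
    using bar by (rule rigidity_transpose_neighbours)
  also have "\<dots> = (\<Sum>j\<in>?O. s {(i, n), (j, n)} *\<^sub>R (q i - q j))
      + (\<Sum>j\<in>?O. s {(i, n), ?x j} *\<^sub>R (q j - q i))"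
    unfolding kagome_neighbours
    by (subst sum.union_disjoint[OF _ _ disj])
      (simp_all add: sum.reindex inj_on_def crystal_framework_def internal_bar external_bar)
  also have "\<dots> = (\<Sum>j\<in>?O. (s {(i, n), (j, n)} - s {(i, n), ?x j}) *\<^sub>R (q i - q j))"
    unfolding sum.distrib[symmetric] by (intro sum.cong refl) (simp add: algebra_simps)
  finally show ?thesis .
qed

text \<open>
The velocity component is carried along a line from \<open>(i, n)\<close> over the internal bar to \<open>(j, n)\<close>, and
on over the external bar to the next vertex of kind \<open>i\<close>.
\<close>

lemma kagome_flex_constant_on_lines:
  assumes flex: "infinitesimal_flex (crystal_framework (kagome_net q)) f" and ij: "i \<noteq> j"
  shows "(q i - q j) \<bullet> f (i, n + (unit_shift j - unit_shift i)) = (q i - q j) \<bullet> f (i, n)"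
proof -
  let ?G = "crystal_framework (kagome_net q)" and ?m = "n + (unit_shift j - unit_shift i)"
  have "{(i, n), (j, n)} \<in> edges ?G" "{(j, n), (i, ?m)} \<in> edges ?G"
    unfolding kagome_edges using ij by blast+
  then have "rigidity_map ?G f {(i, n), (j, n)} = 0" "rigidity_map ?G f {(j, n), (i, ?m)} = 0"
    using flex unfolding infinitesimal_flex_def by blast+
  then have "(q i - q j) \<bullet> (f (i, n) - f (j, n)) = 0" "(q i - q j) \<bullet> (f (j, n) - f (i, ?m)) = 0"
    using ij by (simp_all add: rigidity_map_edge crystal_framework_def internal_bar external_bar)
  then show ?thesis by (simp add: inner_diff_right)
qed

text \<open>
Independence of the edges at a vertex of a tetrahedron makes every coefficient of the force
balance vanish.
\<close>

lemma kagome_stress_opposite_bars: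
  assumes tet: "regular_tetrahedron q"
    and stress: "infinitesimal_stress (crystal_framework (kagome_net q)) s" and ij: "i \<noteq> j"
  shows "s {(i, n), (j, n + (unit_shift i - unit_shift j))} = s {(i, n), (j, n)}"
proof -
  have "rigidity_transpose (crystal_framework (kagome_net q)) s (i, n) = 0"
    using stress by (simp add: infinitesimal_stress_def crystal_framework_def)
  from tetrahedron_edges_independent[OF tet this[unfolded kagome_stress_balance], of j]
  show ?thesis using ij by simp
qed

section \<open>Square-summable flexes and stresses\<close>

text \<open>
The cells met on the line from \<open>(i, n)\<close> in the direction of \<open>q j - q i\<close>.
\<close>

definition along_line :: "4 \<Rightarrow> 4 \<Rightarrow> int^3 \<Rightarrow> nat \<Rightarrow> int^3" where
  "along_line i j n k = n + of_nat k * (unit_shift j - unit_shift i)"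

lemma along_line_0: "along_line i j n 0 = n"
  by (simp add: along_line_def)

lemma along_line_Suc: "along_line i j n (Suc k) = along_line i j n k + (unit_shift j - unit_shift i)"
  by (simp add: along_line_def algebra_simps)

lemma along_line_inj:
  assumes "i \<noteq> j"
  shows "inj (along_line i j n)"
proof -
  have "unit_shift j - unit_shift i \<noteq> 0"
    using assms unit_shift_inj by (auto simp: inj_def)
  then obtain c where "(unit_shift j - unit_shift i) $ c \<noteq> 0"
    by (auto simp: vec_eq_iff)
  then show ?thesis
    by (auto simp: inj_def along_line_def vec_eq_iff of_nat_index)
qed

lemma kagome_flex_zero:
  assumes tet: "regular_tetrahedron q"
    and flex: "infinitesimal_flex (crystal_framework (kagome_net q)) f"
    and l2: "square_summable UNIV f"
  shows "f v = 0"
proof -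
  obtain i n where v: "v = (i, n)" by (cases v)
  have "(q i - q j) \<bullet> f (i, n) = 0" if "j \<noteq> i" for j
  proof -
    let ?g = "\<lambda>k. (i, along_line i j n k)"
    have const: "(q i - q j) \<bullet> f (?g k) = (q i - q j) \<bullet> f (i, n)" for k
      by (induction k)
        (use that kagome_flex_constant_on_lines[OF flex, of i j] in
          \<open>auto simp: along_line_0 along_line_Suc\<close>)
    have "inj ?g"
      using along_line_inj[of i j n] that by (auto simp: inj_def)
    then have "(\<lambda>k. f (?g k)) \<longlonglongrightarrow> 0"
      by (intro square_summable_tendsto_0[OF l2]) auto
    then have "(\<lambda>k. (q i - q j) \<bullet> f (?g k)) \<longlonglongrightarrow> (q i - q j) \<bullet> 0"
      by (intro tendsto_intros)
    then show ?thesis unfolding const by (simp add: LIMSEQ_const_iff)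
  qed
  then show ?thesis unfolding v by (rule tetrahedron_edges_separate[OF tet])
qed

text \<open>
Only the internal bars of a line are followed: a step from one to the next passes through
equilibrium at both ends of the external bar between them. The stress of an external bar equals that of
the internal bar opposite to it.
\<close>

lemma kagome_stress_zero:
  assumes tet: "regular_tetrahedron q"
    and stress: "infinitesimal_stress (crystal_framework (kagome_net q)) s"
    and l2: "square_summable (edges (crystal_framework (kagome_net q))) s"
    and e: "e \<in> edges (crystal_framework (kagome_net q))"
  shows "s e = 0"
proof -
  have internal: "s {(i, n), (j, n)} = 0" if ij: "i \<noteq> j" for i j n
  proof -
    let ?g = "\<lambda>k. {(i, along_line i j n k), (j, along_line i j n k)}"
    have step: "s {(i, m + (unit_shift j - unit_shift i)), (j, m + (unit_shift j - unit_shift i))}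
        = s {(i, m), (j, m)}" for m
    proof -
      let ?m = "m + (unit_shift j - unit_shift i)"
      have "s {(i, ?m), (j, ?m)} = s {(i, ?m), (j, m)}"
        using kagome_stress_opposite_bars[OF tet stress ij, of ?m] by simp
      also have "\<dots> = s {(j, m), (i, ?m)}"
        by (simp only: insert_commute)
      also have "\<dots> = s {(j, m), (i, m)}"
        using kagome_stress_opposite_bars[OF tet stress ij[symmetric], of m] .
      also have "\<dots> = s {(i, m), (j, m)}"
        by (simp only: insert_commute)
      finally show ?thesis .
    qed
    have const: "s (?g k) = s {(i, n), (j, n)}" for k
      by (induction k) (simp_all only: along_line_0 along_line_Suc step)
    have "inj ?g"
      using along_line_inj[OF ij, of n] ij by (auto simp: inj_def doubleton_eq_iff)
    moreover have "range ?g \<subseteq> edges (crystal_framework (kagome_net q))"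
      using ij unfolding kagome_edges by blast
    ultimately have "(\<lambda>k. s (?g k)) \<longlonglongrightarrow> 0"
      by (rule square_summable_tendsto_0[OF l2])
    then show ?thesis unfolding const by (simp add: LIMSEQ_const_iff)
  qed
  from e consider i j n where "i \<noteq> j" "e = {(i, n), (j, n)}"
    | i j n where "i \<noteq> j" "e = {(i, n), (j, n + (unit_shift i - unit_shift j))}"
    unfolding kagome_edges by blast
  then show ?thesis
    using internal kagome_stress_opposite_bars[OF tet stress] by cases simp_all
qed

section \<open>The kernel of the symbol function\<close>

text \<open>
The symbol function pairs a complex vector with the real bar direction bilinearly, without the
conjugation that the complex inner product would bring in.
\<close>

definition component :: "real^3 \<Rightarrow> complex^('k::finite \<times> 3) \<Rightarrow> 'k \<Rightarrow> complex" where
  "component b x \<rho> = (\<Sum>c\<in>UNIV. of_real (b $ c) * x $ (\<rho>, c))"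

lemma matricial_symbol_row:
  fixes x :: "complex^('k::finite \<times> 3)"
  shows "(\<Sum>c\<in>UNIV. matricial_symbol M \<zeta> ((\<kappa>, m), (\<tau>, n)) c * x $ c)
    = conj_monomial \<zeta> m * component (site_pos M (\<kappa>, m) - site_pos M (\<tau>, n)) x \<kappa>
    - conj_monomial \<zeta> n * component (site_pos M (\<kappa>, m) - site_pos M (\<tau>, n)) x \<tau>"
proof -
  define v where "v = site_pos M (\<kappa>, m) - site_pos M (\<tau>, n)"
  have entry: "matricial_symbol M \<zeta> ((\<kappa>, m), (\<tau>, n)) (\<rho>, c)
      = (if \<rho> = \<kappa> then conj_monomial \<zeta> m * of_real (v $ c) else 0)
      - (if \<rho> = \<tau> then conj_monomial \<zeta> n * of_real (v $ c) else 0)" for \<rho> c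
    by (simp only: matricial_symbol.simps Let_def v_def)
  have "(\<Sum>c\<in>UNIV. matricial_symbol M \<zeta> ((\<kappa>, m), (\<tau>, n)) c * x $ c)
      = (\<Sum>\<rho>\<in>UNIV. \<Sum>c\<in>UNIV. matricial_symbol M \<zeta> ((\<kappa>, m), (\<tau>, n)) (\<rho>, c) * x $ (\<rho>, c))"
    by (simp add: sum.cartesian_product del: matricial_symbol.simps)
  also have "\<dots> = (\<Sum>\<rho>\<in>UNIV. (if \<rho> = \<kappa> then conj_monomial \<zeta> m * component v x \<kappa> else 0)
      - (if \<rho> = \<tau> then conj_monomial \<zeta> n * component v x \<tau> else 0))"
    unfolding entry
    by (intro sum.cong refl)
      (simp add: component_def sum_distrib_left sum_subtractf left_diff_distrib mult.assoc)
  also have "\<dots> = conj_monomial \<zeta> m * component v x \<kappa> - conj_monomial \<zeta> n * component v x \<tau>"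
    by (simp add: sum_subtractf)
  finally show ?thesis by (simp only: v_def)
qed

lemma conj_monomial_0: "conj_monomial \<zeta> 0 = 1"
  by (simp add: conj_monomial_def split: prod.splits)

lemma kagome_symbol_kernel:
  "x \<in> symbol_kernel (kagome_net q) \<zeta> \<longleftrightarrow>
     (\<forall>i j. i < j \<longrightarrow> component (q i - q j) x i = component (q i - q j) x j
        \<and> component (q i - q j) x j
            = conj_monomial \<zeta> (unit_shift j - unit_shift i) * component (q i - q j) x i)"
proof -
  have "site_pos (kagome_net q) (j, 0)
      - site_pos (kagome_net q) (i, unit_shift j - unit_shift i) = q i - q j" for i j
    using external_bar[of q j 0 i] by simp
  then show ?thesis
    unfolding symbol_kernel_def
    by (auto simp: kagome_net_def[THEN arg_cong[where f = motif_edges]] ball_Un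
        matricial_symbol_row internal_bar conj_monomial_0 simp del: matricial_symbol.simps)
qed

text \<open>
For exponents \<open>unit_shift j - unit_shift i\<close>, the monomial is the conjugate of the quotient of two of
the phases \<open>1, z, w, u\<close>.
\<close>

lemma equal_phases:
  assumes "\<zeta> \<in> torus3"
  shows "(\<exists>i j. i < j \<and> conj_monomial \<zeta> (unit_shift j - unit_shift i) = 1)
     \<longleftrightarrow> \<zeta> \<in> {(z, w, u). z = 1 \<or> w = 1 \<or> u = 1 \<or> z = w \<or> w = u \<or> u = z}"
proof -
  obtain z w u where \<zeta>: "\<zeta> = (z, w, u)" by (cases \<zeta>)
  have nz: "z \<noteq> 0" "w \<noteq> 0" "u \<noteq> 0" using assms by (auto simp: \<zeta> torus3_def)
  have "(\<exists>i j. i < j \<and> conj_monomial \<zeta> (unit_shift j - unit_shift i) = 1)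
      \<longleftrightarrow> (\<exists>(i, j) \<in> {(i, j). i < (j::4)}. conj_monomial \<zeta> (unit_shift j - unit_shift i) = 1)"
    by auto
  also have "\<dots> \<longleftrightarrow> z = 1 \<or> w = 1 \<or> u = 1 \<or> w = z \<or> u = z \<or> u = w"
    unfolding index_pairs using nz
    by (simp add: \<zeta> conj_monomial_def unit_shift_def axis_def power_int_minus divide_simps)
  finally show ?thesis by (auto simp: \<zeta>)
qed

text \<open>
Off the six planes, the rows force all components of \<open>x\<close> along the edges to vanish. Since the edges
are real vectors, the real and imaginary parts of \<open>x\<close> can be treated separately.
\<close>

lemma kagome_symbol_kernel_trivial:
  assumes tet: "regular_tetrahedron q"
    and distinct: "\<And>i j. i < j \<Longrightarrow> conj_monomial \<zeta> (unit_shift j - unit_shift i) \<noteq> 1"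
    and x: "x \<in> symbol_kernel (kagome_net q) \<zeta>"
  shows "x = 0"
proof -
  have both: "component (q i - q j) x i = 0 \<and> component (q i - q j) x j = 0" if "i < j" for i j
    using x distinct[OF that] that unfolding kagome_symbol_kernel by (metis mult_cancel_right1)
  have flip: "component (q i - q j) x \<rho> = - component (q j - q i) x \<rho>" for i j \<rho>
    by (simp add: component_def left_diff_distrib sum_subtractf)
  have zero: "component (q i - q j) x i = 0" if "j \<noteq> i" for i j
    using both[of i j] both[of j i] flip[of i j] that by (cases i j rule: linorder_cases) auto
  have "x $ (i, c) = 0" for i c
  proof -
    let ?re = "\<chi> c. Re (x $ (i, c))" and ?im = "\<chi> c. Im (x $ (i, c))"
    have "(q i - q j) \<bullet> ?re = 0" "(q i - q j) \<bullet> ?im = 0" if "j \<noteq> i" for j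
      using arg_cong[OF zero[OF that], of Re] arg_cong[OF zero[OF that], of Im]
      by (simp_all add: component_def inner_vec_def)
    then have "?re = 0" "?im = 0"
      by (auto intro!: tetrahedron_edges_separate[OF tet])
    then show ?thesis by (simp add: vec_eq_iff complex_eq_iff)
  qed
  then show ?thesis by (simp add: vec_eq_iff)
qed

text \<open>
The kernel vector moves only the motif vertices \<open>a\<close> and \<open>b\<close>. The dual vectors provide velocities
orthogonal to all edges at these vertices except the common one, along which both have
component 1; the only rows that see the motion are those of the pair \<open>a, b\<close>, and they are satisfied when the
phases of \<open>a\<close> and \<open>b\<close> coincide.
\<close>

lemma kagome_symbol_kernel_nontrivial:
  assumes tet: "regular_tetrahedron q"
    and ab: "a < b" and phase: "conj_monomial \<zeta> (unit_shift b - unit_shift a) = 1"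
  obtains x where "x \<in> symbol_kernel (kagome_net q) \<zeta>" and "x \<noteq> 0"
proof -
  obtain h where one: "\<And>i j. i \<noteq> j \<Longrightarrow> (q i - q j) \<bullet> h j = 1"
    and zero: "\<And>i j k. i \<noteq> j \<Longrightarrow> k \<noteq> j \<Longrightarrow> (q i - q k) \<bullet> h j = 0"
    using regular_tetrahedron_dual_vectors[OF tet] by blast
  \<comment> \<open>The sign of \<open>h a\<close> compensates for the reversal of the edge: \<open>h a\<close> is normalised on \<open>q b - q a\<close>.\<close>
  define g where "g \<rho> = (if \<rho> = a then h b else if \<rho> = b then - h a else 0)" for \<rho>
  define x where "x = (\<chi> p. complex_of_real (g (fst p) $ snd p))"
  have comp: "component v x \<rho> = of_real (v \<bullet> g \<rho>)" for v \<rho>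
    by (simp add: component_def x_def inner_vec_def)
  have one': "(q i - q j) \<bullet> h i = - 1" if "i \<noteq> j" for i j
    using one[of j i] that by (simp add: inner_diff_left)
  have "(q i - q j) \<bullet> g i = (if i = a \<and> j = b then 1 else 0) \<and>
        (q i - q j) \<bullet> g j = (if i = a \<and> j = b then 1 else 0)" if "i < j" for i j
    using that ab by (auto simp: g_def one one' zero)
  then have "x \<in> symbol_kernel (kagome_net q) \<zeta>"
    unfolding kagome_symbol_kernel comp using phase by simp
  moreover have "component (q a - q b) x a = 1"
    using ab by (simp add: comp g_def one)
  then have "x \<noteq> 0" by (auto simp: component_def)
  ultimately show ?thesis by (rule that)
qed

theorem theorem5p13:
  fixes q :: "4 \<Rightarrow> real^3"
  assumes "regular_tetrahedron q"
  shows "(square_summably_isostatic (crystal_framework (kagome_net q)) \<and>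
          \<not> (\<exists>f. internal_flex (crystal_framework (kagome_net q)) f \<and>
                 (\<exists>v\<in>verts (crystal_framework (kagome_net q)). f v \<noteq> 0))) \<and>
         {\<zeta> \<in> torus3. mode_multiplicity (kagome_net q) \<zeta> \<noteq> 0} =
           torus3 \<inter> {(z, w, u). z = 1 \<or> w = 1 \<or> u = 1 \<or> z = w \<or> w = u \<or> u = z}"
proof (intro conjI)
  let ?G = "crystal_framework (kagome_net q)"
  have verts: "verts ?G = UNIV" by (simp add: crystal_framework_def)
  show "square_summably_isostatic ?G"
    unfolding square_summably_isostatic_def verts
    using kagome_flex_zero[OF assms] kagome_stress_zero[OF assms] by blast
  show "\<not> (\<exists>f. internal_flex ?G f \<and> (\<exists>v\<in>verts ?G. f v \<noteq> 0))"
    unfolding internal_flex_def verts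
    using kagome_flex_zero[OF assms] finite_support_square_summable by blast
  have "mode_multiplicity (kagome_net q) \<zeta> \<noteq> 0 \<longleftrightarrow>
      \<zeta> \<in> {(z, w, u). z = 1 \<or> w = 1 \<or> u = 1 \<or> z = w \<or> w = u \<or> u = z}" if "\<zeta> \<in> torus3" for \<zeta>
  proof -
    have "mode_multiplicity (kagome_net q) \<zeta> \<noteq> 0 \<longleftrightarrow>
        (\<exists>x \<in> symbol_kernel (kagome_net q) \<zeta>. x \<noteq> 0)"
      by (auto simp: mode_multiplicity_def)
    also have "\<dots> \<longleftrightarrow> (\<exists>i j. i < j \<and> conj_monomial \<zeta> (unit_shift j - unit_shift i) = 1)"
      using kagome_symbol_kernel_trivial[OF assms] kagome_symbol_kernel_nontrivial[OF assms]
      by metis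
    finally show ?thesis using equal_phases[OF that] by simp
  qed
  then show "{\<zeta> \<in> torus3. mode_multiplicity (kagome_net q) \<zeta> \<noteq> 0} =
      torus3 \<inter> {(z, w, u). z = 1 \<or> w = 1 \<or> u = 1 \<or> z = w \<or> w = u \<or> u = z}"
    by blast
qed

end
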